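(* Let $\mathcal{C}\subseteq\mathbb{R}^n$ be a closed convex set, let $f:\mathbb{R}^n\to\mathbb{R}$ be a continuous function bounded below, let $\{\mathbf{x}_k\}\subset\mathcal{C}$ be the sequence of iterates, and for each $k$ let $\hat g_k$ be a real-valued function. Assume that there exist $K>0$, finite constants $\gamma_u,\gamma_l>0$, and $\epsilon>0$ such that $$\hat g_k(\mathbf{x})+\gamma_u\|\mathbf{x}-\mathbf{x}_k\|_2^2\;\ge\; f(\mathbf{x})\;\ge\;\hat g_k(\mathbf{x})-\gamma_l\|\mathbf{x}-\mathbf{x}_k\|_2^2$$ holds for all $k\ge K$ and all $\mathbf{x}\in\mathcal{C}$ such that $\|\mathbf{x}-\mathbf{x}_k\|\le\epsilon$, where the equality holds if and only if $\mathbf{x}=\mathbf{x}_k$. Then, for $g_k(\mathbf{x})=\hat g_k(\mathbf{x})+\gamma_u\|\mathbf{x}-\mathbf{x}_k\|_2^2$, one has $$\lim_{k\to\infty}\left(\nabla f(\mathbf{x}_k;\mathbf{d})-\nabla g_k(\mathbf{x}_k;\mathbf{d})\right)=0,\qquad\forall\,\mathbf{x}_k+\mathbf{d}\in\mathcal{C}.$$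
   Context: The setting is a majorization-minimization scheme for $\min_{\mathbf{x}\in\mathcal{C}}f(\mathbf{x})$, in which $g_k$ is the surrogate function of $f$ at the current iterate $\mathbf{x}_k\in\mathcal{C}$ and $\mathbf{x}_{k+1}=\operatorname{argmin}_{\mathbf{x}\in\mathcal{C}}g_k(\mathbf{x})$. Directional derivative: for a function $h$ and a feasible direction $\mathbf{d}$ at $\mathbf{x}$ (i.e. $\mathbf{x}+\mathbf{d}\in\mathcal{C}$), $$\nabla h(\mathbf{x};\mathbf{d})=\liminf_{\theta\downarrow 0}\frac{h(\mathbf{x}+\theta\mathbf{d})-h(\mathbf{x})}{\theta}.$$ *)

theory Defs
  imports "HOL-Analysis.Analysis"
begin

(* A lower limit of difference quotients may be infinite even for continuous h,
   hence the value lives in ereal.  Feasibility of the direction d is a condition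
   imposed where the derivative is used. *)
definition dir_deriv :: "('a::real_vector \<Rightarrow> real) \<Rightarrow> 'a \<Rightarrow> 'a \<Rightarrow> ereal" where
  "dir_deriv h x d = Liminf (at_right 0) (\<lambda>\<theta>::real. ereal ((h (x + \<theta> *\<^sub>R d) - h x) / \<theta>))"

(* The difference of two extended reals.  It agrees with subtraction on ereal, except in
   the indeterminate case of two equal infinities: there the library value is \<infinity>,
   an artefact of totality, and coinciding values are given difference 0 instead.
   An infinite value and a different one still have an infinite difference. *)
definition ext_diff :: "ereal \<Rightarrow> ereal \<Rightarrow> ereal" where
  "ext_diff a b = (if \<bar>a\<bar> = \<infinity> \<and> a = b then 0 else a - b)"

end

theory Submission
  imports Defs
begin

text \<open>Along a feasible direction \<open>f\<close> and \<open>g k\<close> agree at the iterate and differ by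
\<open>O(\<theta>\<^sup>2)\<close>, so their difference quotients differ by \<open>O(\<theta>)\<close>. Both lower derivatives therefore
coincide, even when infinite, and the sequence in question is \<open>0\<close> from index \<open>K\<close> on.\<close>

text \<open>For each real \<open>e > 0\<close> eventually \<open>q t < r t + e\<close>, and a finite
  shift passes through \<open>Liminf\<close>. Comparing up to \<open>e\<close> instead of
  subtracting the two lower limits also covers infinite values.\<close>

lemma Liminf_ereal_le_if_diff_tendsto_0:
  fixes q r :: "'a \<Rightarrow> real"
  assumes "((\<lambda>t. q t - r t) \<longlongrightarrow> 0) F" and "F \<noteq> bot"
  shows "Liminf F (\<lambda>t. ereal (q t)) \<le> Liminf F (\<lambda>t. ereal (r t))"
proof (rule ereal_le_epsilon2)
  fix e :: real assume "e > 0"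
  have "eventually (\<lambda>t. q t - r t < e) F"
    using order_tendstoD(2)[OF assms(1) \<open>e > 0\<close>] .
  then have "eventually (\<lambda>t. ereal (q t) \<le> ereal (r t) + ereal e) F"
    by eventually_elim simp
  then have "Liminf F (\<lambda>t. ereal (q t)) \<le> Liminf F (\<lambda>t. ereal (r t) + ereal e)"
    by (rule Liminf_mono)
  \<comment> \<open>The finite constant \<open>e\<close> leaves the lower limit because
    \<open>F\<close> is nontrivial.\<close>
  also have "\<dots> = Liminf F (\<lambda>t. ereal (r t)) + ereal e"
    using assms(2) by (intro Liminf_add_ereal_right) auto
  finally show "Liminf F (\<lambda>t. ereal (q t)) \<le> Liminf F (\<lambda>t. ereal (r t)) + ereal e" .
qed

lemma Liminf_ereal_eq_if_diff_tendsto_0: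
  fixes q r :: "'a \<Rightarrow> real"
  assumes "((\<lambda>t. q t - r t) \<longlongrightarrow> 0) F" and "F \<noteq> bot"
  shows "Liminf F (\<lambda>t. ereal (q t)) = Liminf F (\<lambda>t. ereal (r t))"
  using Liminf_ereal_le_if_diff_tendsto_0[OF assms]
    Liminf_ereal_le_if_diff_tendsto_0[of r q] tendsto_minus[OF assms(1)] assms(2)
  by (intro antisym) auto

text \<open>The bound holds only on \<open>C\<close> near \<open>x\<close>. Convexity keeps the
  segment from \<open>x\<close> to \<open>x + d\<close> in \<open>C\<close>, so the bound applies to
  every small step along \<open>d\<close>.\<close>

lemma dir_deriv_eq_if_quadratically_close:
  fixes f g :: "'a::real_normed_vector \<Rightarrow> real"
  assumes "convex C" "x \<in> C" "x + d \<in> C" "\<epsilon> > 0"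
    and close: "\<And>y. y \<in> C \<Longrightarrow> norm (y - x) \<le> \<epsilon> \<Longrightarrow> \<bar>f y - g y\<bar> \<le> c * (norm (y - x))\<^sup>2"
  shows "dir_deriv f x d = dir_deriv g x d"
  unfolding dir_deriv_def
proof (rule Liminf_ereal_eq_if_diff_tendsto_0)
  \<comment> \<open>At \<open>y = x\<close> the quadratic bound is 0.\<close>
  have fg: "f x = g x"
    using close[of x] assms by simp
  have "((\<lambda>t. t * norm d) \<longlongrightarrow> 0 * norm d) (at_right 0)"
    by (intro tendsto_intros)
  \<comment> \<open>Stated without dividing by \<open>norm d\<close>, so that \<open>d = 0\<close>
    is no special case.\<close>
  then have small: "eventually (\<lambda>t. t * norm d < \<epsilon>) (at_right 0)"
    using \<open>\<epsilon> > 0\<close> by (auto dest: order_tendstoD(2))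
  have "eventually (\<lambda>t::real. t > 0 \<and> t < 1) (at_right 0)"
    by (auto simp: eventually_at_right_field intro: exI[of _ 1])
  with small have "eventually (\<lambda>t. norm ((f (x + t *\<^sub>R d) - f x) / t - (g (x + t *\<^sub>R d) - g x) / t)
      \<le> c * (norm d)\<^sup>2 * t) (at_right 0)"
  proof eventually_elim
    case (elim t)
    have "x + t *\<^sub>R d = (1 - t) *\<^sub>R x + t *\<^sub>R (x + d)"
      by (simp add: algebra_simps)
    with elim assms have "x + t *\<^sub>R d \<in> C"
      by (simp add: convexD)
    then have "\<bar>f (x + t *\<^sub>R d) - g (x + t *\<^sub>R d)\<bar> \<le> c * (t * norm d)\<^sup>2"
      using close[of "x + t *\<^sub>R d"] elim by simp
    moreover have "(f (x + t *\<^sub>R d) - f x) / t - (g (x + t *\<^sub>R d) - g x) / t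
        = (f (x + t *\<^sub>R d) - g (x + t *\<^sub>R d)) / t"
      by (simp add: fg diff_divide_distrib)
    \<comment> \<open>One factor \<open>t\<close> of the quadratic bound cancels against the
      denominator, the other remains and tends to 0.\<close>
    ultimately show ?case
      using elim by (simp add: divide_le_eq power2_eq_square mult_ac)
  qed
  moreover have "((\<lambda>t. c * (norm d)\<^sup>2 * t) \<longlongrightarrow> 0) (at_right 0)"
    by (auto intro!: tendsto_eq_intros)
  ultimately show "((\<lambda>t. (f (x + t *\<^sub>R d) - f x) / t - (g (x + t *\<^sub>R d) - g x) / t) \<longlongrightarrow> 0) (at_right 0)"
    by (rule Lim_null_comparison)
qed simp

text \<open>For fixed \<open>d\<close> the limit is taken along those \<open>k\<close> at which
  \<open>d\<close> is feasible; if they are only finitely many, the filter is trivial and the claim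
  is vacuous.\<close>

theorem proposition1:
  fixes C :: "(real ^ 'n) set"
    and f :: "real ^ 'n \<Rightarrow> real"
    and ghat g :: "nat \<Rightarrow> real ^ 'n \<Rightarrow> real"
    and x :: "nat \<Rightarrow> real ^ 'n"
    and K :: nat
    and \<gamma>\<^sub>u \<gamma>\<^sub>l \<epsilon> :: real
  assumes "closed C" and "convex C"
    and "continuous_on UNIV f" and "bdd_below (range f)"
    and "\<And>k. x k \<in> C"
    and "\<And>k y. g k y = ghat k y + \<gamma>\<^sub>u * (norm (y - x k))\<^sup>2"
    and "\<And>k. is_arg_min (g k) (\<lambda>y. y \<in> C) (x (Suc k))"
    and "K > 0" and "\<gamma>\<^sub>u > 0" and "\<gamma>\<^sub>l > 0" and "\<epsilon> > 0"
    and "\<And>k y. k \<ge> K \<Longrightarrow> y \<in> C \<Longrightarrow> norm (y - x k) \<le> \<epsilon> \<Longrightarrow>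
           ghat k y + \<gamma>\<^sub>u * (norm (y - x k))\<^sup>2 \<ge> f y \<and>
           f y \<ge> ghat k y - \<gamma>\<^sub>l * (norm (y - x k))\<^sup>2"
    and "\<And>k y. k \<ge> K \<Longrightarrow> y \<in> C \<Longrightarrow> norm (y - x k) \<le> \<epsilon> \<Longrightarrow>
           (ghat k y + \<gamma>\<^sub>u * (norm (y - x k))\<^sup>2 = f y \<longleftrightarrow> y = x k) \<and>
           (f y = ghat k y - \<gamma>\<^sub>l * (norm (y - x k))\<^sup>2 \<longleftrightarrow> y = x k)"
  shows "\<forall>d. ((\<lambda>k. ext_diff (dir_deriv f (x k) d) (dir_deriv (g k) (x k) d)) \<longlongrightarrow> 0)
               (inf sequentially (principal {k. x k + d \<in> C}))"
proof
  fix d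
  have "ext_diff (dir_deriv f (x k) d) (dir_deriv (g k) (x k) d) = 0"
    if "k \<ge> K" "x k + d \<in> C" for k
  proof -
    \<comment> \<open>The upper bound says \<open>f y - g k y \<le> 0\<close>. Rewriting
      \<open>ghat\<close> through \<open>g\<close> in the lower bound adds
      \<open>\<gamma>\<^sub>u\<close> to \<open>\<gamma>\<^sub>l\<close>.\<close>
    have "\<bar>f y - g k y\<bar> \<le> (\<gamma>\<^sub>u + \<gamma>\<^sub>l) * (norm (y - x k))\<^sup>2"
      if "y \<in> C" "norm (y - x k) \<le> \<epsilon>" for y
    proof -
      have "0 \<le> (\<gamma>\<^sub>u + \<gamma>\<^sub>l) * (norm (y - x k))\<^sup>2"
        using assms(9,10) by simp
      with assms(12)[OF \<open>k \<ge> K\<close> that] show ?thesis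
        unfolding assms(6) distrib_right by linarith
    qed
    from dir_deriv_eq_if_quadratically_close[OF assms(2) assms(5) that(2) assms(11) this]
    have "dir_deriv f (x k) d = dir_deriv (g k) (x k) d" .
    then show ?thesis
      \<comment> \<open>Finite values cancel by subtraction; equal infinities give 0 by the first
        branch of \<open>ext_diff\<close>.\<close>
      by (cases "dir_deriv (g k) (x k) d") (auto simp: ext_diff_def)
  qed
  \<comment> \<open>The threshold is \<open>K\<close>, whatever \<open>d\<close> is.\<close>
  then have "eventually (\<lambda>k. ext_diff (dir_deriv f (x k) d) (dir_deriv (g k) (x k) d) = 0)
      (inf sequentially (principal {k. x k + d \<in> C}))"
    unfolding eventually_inf_principal eventually_sequentially by blast
  then show "((\<lambda>k. ext_diff (dir_deriv f (x k) d) (dir_deriv (g k) (x k) d)) \<longlongrightarrow> 0)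
      (inf sequentially (principal {k. x k + d \<in> C}))"
    by (rule tendsto_eventually)
qed

end
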